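(* Let $A\in\{0,1\}^\omega$. The following are equivalent. (1) There is some set $B$ such that $A\le_{T(tu)}B$. (2) $A$ is anti-complex. (3) $g_A$ is dominant. (4) $A\le_{uT(tu)}A^*$.
   Context: "Recursive" means computable. Sets are subsets of $\omega$, identified with elements of $\{0,1\}^\omega$; $A\upharpoonright n=A(0)\cdots A(n-1)$. An order function is a recursive nondecreasing unbounded function $h:\omega\to\omega$. A function $f$ dominates $g$ (and $g$ is dominated by $f$) if $f(n)\ge g(n)$ for all but finitely many $n$; $f$ is dominant if it dominates every recursive function. Use: if $\Phi$ is a Turing reduction with $\Phi^B=A$, where before computing $\Phi^B(n)$ the machine first computes $\Phi^B(m)$ for all $m<n$, then the use function is $\varphi(n)=m+1$ where $m$ is the largest number queried while computing $A\upharpoonright n$ (and $0$ if there are no queries). $A\le_{T(tu)}B$ means: for every order function $h$ there is a Turing reduction of $A$ to $B$ whose use function is bounded by $h$. $A\le_{uT(tu)}B$ means: there is a single Turing reduction $\Phi^B=A$ whose use function is dominated by every order function. Plain complexity: a machine is a partial recursive $M:\{0,1\}^*\to\{0,1\}^*$; $C_M(\sigma)$ is the length of a shortest $\tau$ with $M(\tau)=\sigma$ ($\infty$ if none). Fix an optimal machine $U$ (for every machine $M$ there is $c$ with $C_U(\sigma)\le C_M(\sigma)+c$ for all $\sigma$) and let $C=C_U$. $A$ is anti-complex if for every order function $f$, for all but finitely many $n$, $C(A\upharpoonright f(n))\le n$. Binary strings are identified with natural numbers by a length-first ordering, so that a string $x$ of length $|x|$ is coded by a number with $2^{|x|}\le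 x<2^{|x|+1}$. For a string $x$, $x^*$ is the least element of $U^{-1}\{x\}$ (so $C(x)=|x^*|$). For $A\in\{0,1\}^\omega$, $g_A(k)$ is the least $n$ such that $C(A\upharpoonright m)>k$ for all $m\ge n$, and $A^*=\{(A\upharpoonright g_A(k))^*: k<\omega\}$, regarded as a set of natural numbers. *)

theory Defs
  imports "HOL-Library.Extended_Nat" "HOL-Library.Infinite_Set"
begin

section \<open>Oracle computation\<close>

text \<open>
  Programs are Kleene's schemes for the partial recursive functions, extended by a scheme for
  querying an oracle. A function is computed by a program exactly if it is computed by an oracle
  Turing machine; moreover either model can simulate the other without changing the set of
  queries, so the notion of use below is that of oracle machines.
\<close>

datatype prog =
    Zero
  | Succ
  | Proj nat
  | Query
  | Comp prog "prog list"
  | PrimRec prog prog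
  | Mu prog

text \<open>
  \<open>eval B p xs y Q\<close>: with oracle \<open>B\<close>, program \<open>p\<close> halts on input \<open>xs\<close> with output \<open>y\<close>, and \<open>Q\<close> is
  the set of all numbers queried during the computation. In \<open>Mu\<close>, the computations of \<open>p\<close> at all
  arguments below the minimum must halt as well, and their queries count.
\<close>

inductive eval :: "nat set \<Rightarrow> prog \<Rightarrow> nat list \<Rightarrow> nat \<Rightarrow> nat set \<Rightarrow> bool" for B :: "nat set" where
  Zero: "eval B Zero xs 0 {}"
| Succ: "eval B Succ [x] (Suc x) {}"
| Proj: "i < length xs \<Longrightarrow> eval B (Proj i) xs (xs ! i) {}"
| Query: "eval B Query [x] (of_bool (x \<in> B)) {x}"
| Comp: "\<lbrakk>length ys = length gs; \<forall>i<length gs. eval B (gs ! i) xs (ys ! i) (Qs i);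
    eval B f ys z R\<rbrakk> \<Longrightarrow> eval B (Comp f gs) xs z ((\<Union>i<length gs. Qs i) \<union> R)"
| PrimRec_0: "eval B f xs z Q \<Longrightarrow> eval B (PrimRec f g) (0 # xs) z Q"
| PrimRec_Suc: "\<lbrakk>eval B (PrimRec f g) (n # xs) y Q; eval B g (n # y # xs) z R\<rbrakk>
    \<Longrightarrow> eval B (PrimRec f g) (Suc n # xs) z (Q \<union> R)"
| Mu: "\<lbrakk>eval B f (n # xs) 0 (Qs n); \<forall>m<n. eval B f (m # xs) (Suc (ys m)) (Qs m)\<rbrakk>
    \<Longrightarrow> eval B (Mu f) xs n (\<Union>m\<le>n. Qs m)"

lemma eval_finite: "eval B p xs y Q \<Longrightarrow> finite Q"
  by (induction rule: eval.induct) (auto simp: le_less)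

inductive_cases eval_ZeroE: "eval B Zero xs y Q"
inductive_cases eval_SuccE: "eval B Succ xs y Q"
inductive_cases eval_ProjE: "eval B (Proj i) xs y Q"
inductive_cases eval_QueryE: "eval B Query xs y Q"
inductive_cases eval_CompE: "eval B (Comp f gs) xs y Q"
inductive_cases eval_PrimRec_0E: "eval B (PrimRec f g) (0 # xs) y Q"
inductive_cases eval_PrimRec_SucE: "eval B (PrimRec f g) (Suc n # xs) y Q"
inductive_cases eval_MuE: "eval B (Mu f) xs y Q"

lemma eval_deterministic:
  "eval B p xs y Q \<Longrightarrow> eval B p xs y' Q' \<Longrightarrow> y' = y \<and> Q' = Q"
proof (induction arbitrary: y' Q' rule: eval.induct)
  case (Zero xs)
  then show ?case by (blast elim: eval_ZeroE)
next
  case (Succ x)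
  then show ?case by (blast elim: eval_SuccE)
next
  case (Proj i xs)
  from Proj.prems show ?case by (rule eval_ProjE) simp
next
  case (Query x)
  from Query.prems show ?case by (rule eval_QueryE) simp
next
  case (Comp ys gs xs Qs f z R)
  from Comp.prems show ?case
  proof (rule eval_CompE)
    fix ys' Qs' R'
    assume *: "length ys' = length gs" "\<forall>i<length gs. eval B (gs ! i) xs (ys' ! i) (Qs' i)"
      "eval B f ys' y' R'" "Q' = (\<Union>i<length gs. Qs' i) \<union> R'"
    have "\<forall>i<length gs. ys' ! i = ys ! i \<and> Qs' i = Qs i"
      using Comp.IH(1) *(2) by blast
    then have "ys' = ys" "(\<Union>i<length gs. Qs' i) = (\<Union>i<length gs. Qs i)"
      using *(1) Comp.hyps by (auto intro: nth_equalityI)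
    moreover from this have "y' = z \<and> R' = R"
      using Comp.IH(2) *(3) by simp
    ultimately show ?thesis
      using *(4) by simp
  qed
next
  case (PrimRec_0 f xs z Q g)
  from PrimRec_0.prems have "eval B f xs y' Q'"
    by (rule eval_PrimRec_0E)
  then show ?case by (rule PrimRec_0.IH)
next
  case (PrimRec_Suc f g n xs y Q z R)
  from PrimRec_Suc.prems show ?case
    by (rule eval_PrimRec_SucE) (use PrimRec_Suc.IH in blast)
next
  case (Mu f n xs Qs ys)
  from Mu.prems show ?case
  proof (rule eval_MuE)
    fix Qs' ys'
    assume *: "eval B f (y' # xs) 0 (Qs' y')"
      "\<forall>m<y'. eval B f (m # xs) (Suc (ys' m)) (Qs' m)" "Q' = (\<Union>m\<le>y'. Qs' m)"
    have "\<not> y' < n" using Mu.IH(2) *(1) by (metis nat.distinct(1))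
    moreover have "\<not> n < y'" using Mu.IH(1) *(2) by (metis nat.distinct(1))
    ultimately have y': "y' = n" by simp
    then have "\<forall>m\<le>n. Qs' m = Qs m"
      using Mu.IH *(1,2) by (metis le_less)
    then show ?thesis using *(3) y' by simp
  qed
qed

fun oracle_free :: "prog \<Rightarrow> bool" where
  "oracle_free Zero \<longleftrightarrow> True"
| "oracle_free Succ \<longleftrightarrow> True"
| "oracle_free (Proj i) \<longleftrightarrow> True"
| "oracle_free Query \<longleftrightarrow> False"
| "oracle_free (Comp f gs) \<longleftrightarrow> oracle_free f \<and> (\<forall>g\<in>set gs. oracle_free g)"
| "oracle_free (PrimRec f g) \<longleftrightarrow> oracle_free f \<and> oracle_free g"
| "oracle_free (Mu f) \<longleftrightarrow> oracle_free f"

text \<open>For oracle-free programs the oracle argument of \<^const>\<open>eval\<close> is irrelevant.\<close>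

definition recursive :: "(nat \<Rightarrow> nat) \<Rightarrow> bool" where
  "recursive f \<longleftrightarrow> (\<exists>p. oracle_free p \<and> (\<forall>n. \<exists>Q. eval {} p [n] (f n) Q))"

definition order_function :: "(nat \<Rightarrow> nat) \<Rightarrow> bool" where
  "order_function h \<longleftrightarrow> recursive h \<and> mono h \<and> (\<forall>b. \<exists>n. b \<le> h n)"

definition dominates :: "(nat \<Rightarrow> nat) \<Rightarrow> (nat \<Rightarrow> nat) \<Rightarrow> bool" where
  "dominates f g \<longleftrightarrow> (\<forall>\<^sub>\<infinity>n. g n \<le> f n)"

definition dominant :: "(nat \<Rightarrow> nat) \<Rightarrow> bool" where
  "dominant f \<longleftrightarrow> (\<forall>g. recursive g \<longrightarrow> dominates f g)"

section \<open>Turing reductions with bounded use\<close>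

definition turing_reduction :: "prog \<Rightarrow> nat set \<Rightarrow> nat set \<Rightarrow> bool" where
  "turing_reduction p A B \<longleftrightarrow> (\<forall>n. \<exists>Q. eval B p [n] (of_bool (n \<in> A)) Q)"

definition queries :: "prog \<Rightarrow> nat set \<Rightarrow> nat \<Rightarrow> nat set" where
  "queries p B n = \<Union> {Q. \<exists>y. eval B p [n] y Q}"

text \<open>
  The first \<open>n\<close> values are computed successively, so the queries made while computing them are
  those made at the arguments \<open>k < n\<close>. This set is finite by \<open>eval_finite\<close> and
  \<open>eval_deterministic\<close>.
\<close>

definition use_fun :: "prog \<Rightarrow> nat set \<Rightarrow> nat \<Rightarrow> nat" where
  "use_fun p B n =
    (let Q = (\<Union>k<n. queries p B k) in if Q = {} then 0 else Max Q + 1)"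

definition T_tu_reducible :: "nat set \<Rightarrow> nat set \<Rightarrow> bool"  (infix "\<le>\<^sub>T\<^sub>t\<^sub>u" 50) where
  "A \<le>\<^sub>T\<^sub>t\<^sub>u B \<longleftrightarrow>
    (\<forall>h. order_function h \<longrightarrow> (\<exists>p. turing_reduction p A B \<and> (\<forall>n. use_fun p B n \<le> h n)))"

definition uT_tu_reducible :: "nat set \<Rightarrow> nat set \<Rightarrow> bool"  (infix "\<le>\<^sub>u\<^sub>T\<^sub>t\<^sub>u" 50) where
  "A \<le>\<^sub>u\<^sub>T\<^sub>t\<^sub>u B \<longleftrightarrow>
    (\<exists>p. turing_reduction p A B \<and> (\<forall>h. order_function h \<longrightarrow> dominates h (use_fun p B)))"

section \<open>Plain Kolmogorov complexity\<close>

type_synonym str = "bool list"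

text \<open>
  The code of \<open>x\<close> is the number with binary expansion \<open>1x\<close>. This is the length-first
  (then lexicographic) ordering, and it satisfies \<open>2 ^ length x \<le> str_code x < 2 ^ (length x + 1)\<close>;
  in particular 0 is not a code.
\<close>

definition str_code :: "str \<Rightarrow> nat" where
  "str_code x = foldl (\<lambda>c b. 2 * c + of_bool b) 1 x"

type_synonym machine = "str \<Rightarrow> str option"

definition partial_recursive :: "machine \<Rightarrow> bool" where
  "partial_recursive M \<longleftrightarrow> (\<exists>p. oracle_free p \<and>
    (\<forall>\<sigma> y. (\<exists>Q. eval {} p [str_code \<sigma>] y Q) \<longleftrightarrow> (\<exists>\<tau>. M \<sigma> = Some \<tau> \<and> y = str_code \<tau>)))"

text \<open>The infimum of the empty set is \<open>\<infinity>\<close>.\<close>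

definition complexity :: "machine \<Rightarrow> str \<Rightarrow> enat" where
  "complexity M \<sigma> = (INF \<tau>\<in>{\<tau>. M \<tau> = Some \<sigma>}. enat (length \<tau>))"

definition optimal :: "machine \<Rightarrow> bool" where
  "optimal U \<longleftrightarrow> partial_recursive U \<and>
    (\<forall>M. partial_recursive M \<longrightarrow>
      (\<exists>c::nat. \<forall>\<sigma>. complexity U \<sigma> \<le> complexity M \<sigma> + enat c))"

definition initial_segment :: "nat set \<Rightarrow> nat \<Rightarrow> str"  (infix "\<restriction>" 75) where
  "A \<restriction> n = map (\<lambda>i. i \<in> A) [0..<n]"

definition anti_complex :: "machine \<Rightarrow> nat set \<Rightarrow> bool" where
  "anti_complex U A \<longleftrightarrow>
    (\<forall>f. order_function f \<longrightarrow> (\<forall>\<^sub>\<infinity>n. complexity U (A \<restriction> f n) \<le> enat n))"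

definition shortest_description :: "machine \<Rightarrow> str \<Rightarrow> str" where
  "shortest_description U x = (ARG_MIN str_code \<tau>. U \<tau> = Some x)"

definition g_fun :: "machine \<Rightarrow> nat set \<Rightarrow> nat \<Rightarrow> nat" where
  "g_fun U A k = (LEAST n. \<forall>m\<ge>n. complexity U (A \<restriction> m) > enat k)"

definition star_set :: "machine \<Rightarrow> nat set \<Rightarrow> nat set" where
  "star_set U A = range (\<lambda>k. str_code (shortest_description U (A \<restriction> g_fun U A k)))"

end

theory Submission
  imports Defs
begin

text \<open>
  From (1), pick an order function \<open>h\<close> with \<open>h(f(n)) \<le> n\<close>: a reduction of \<open>A\<close> to \<open>B\<close> with use
  bounded by \<open>h\<close> computes \<open>A \<restriction> f(n)\<close> from the string \<open>B \<restriction> n\<close>, so that \<open>C(A \<restriction> f(n)) \<le> n + c\<close>.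
  Anti-complexity gives \<open>g\<^sub>A(n) > f(n)\<close> directly. Conversely, if \<open>g\<^sub>A(k) > f(k+1)\<close>, then \<open>A \<restriction> f(k+1)\<close>
  is a prefix of \<open>U(\<tau>)\<close> for some \<open>\<tau>\<close> of length at most \<open>k\<close>, and the padded string \<open>0\<dots>01\<tau>\<close> of length
  \<open>k+1\<close> encodes both \<open>\<tau>\<close> and, through its length, the length of the prefix. For (4), search \<open>A\<^sup>*\<close>
  in increasing order for a description of a string longer than \<open>n\<close>. Since
  \<open>C(A \<restriction> g\<^sub>A(k)) \<le> k + c\<close>, this queries only numbers below \<open>2\<^sup>k\<^sup>+\<^sup>c\<^sup>+\<^sup>1\<close> whenever \<open>g\<^sub>A(k) > n\<close>; for
  the least such \<open>k\<close> this bound is dominated by every order function of \<open>n\<close> if \<open>g\<^sub>A\<close> is dominant. Finally, (4) implies (1) because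
  finitely many values can be stored in the program.
\<close>

section \<open>Computable functions\<close>

lemma eval_Comp1:
  "eval B g xs y Q \<Longrightarrow> eval B f [y] z R \<Longrightarrow> eval B (Comp f [g]) xs z (Q \<union> R)"
  using eval.Comp[of "[y]" "[g]" B xs "\<lambda>_. Q" f z R] by (simp add: lessThan_Suc)

lemma eval_Comp2:
  assumes "eval B g xs y Q" "eval B g' xs y' Q'" "eval B f [y, y'] z R"
  shows "eval B (Comp f [g, g']) xs z (Q \<union> Q' \<union> R)"
proof -
  have "eval B (Comp f [g, g']) xs z
      ((\<Union>i<length [g, g']. if i = 0 then Q else Q') \<union> R)"
    using assms by (intro eval.Comp[of "[y, y']"]) (auto simp: less_Suc_eq)
  then show ?thesis by (simp add: lessThan_Suc Un_commute)
qed

lemma eval_Proj: "i < length xs \<Longrightarrow> y = xs ! i \<Longrightarrow> eval B (Proj i) xs y {}"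
  by (simp add: eval.Proj)

text \<open>Only \<open>Query\<close> consults the oracle or enlarges the query set. So a program
  known to halt under the oracle \<open>{}\<close> can run inside a reduction without adding to its
  use.\<close>

lemma oracle_free_eval:
  "eval B p xs y Q \<Longrightarrow> oracle_free p \<Longrightarrow> Q = {} \<and> eval B' p xs y {}"
proof (induction rule: eval.induct)
  case (Comp ys gs xs Qs f z R)
  then have "\<forall>i<length gs. Qs i = {} \<and> eval B' (gs ! i) xs (ys ! i) {}" by simp
  moreover have "R = {}" "eval B' f ys z {}" using Comp by auto
  ultimately show ?case
    using eval.Comp[of ys gs B' xs "\<lambda>_. {}" f z "{}"] Comp.hyps by simp
next
  case (PrimRec_Suc f g n xs y Q z R)
  then show ?case using eval.PrimRec_Suc[of B' f g n xs y "{}" z "{}"] by simp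
next
  case (Mu f n xs Qs ys)
  then have "\<forall>m\<le>n. Qs m = {}" by (auto simp: le_less)
  then show ?case
    using Mu eval.Mu[of B' f n xs "\<lambda>_. {}" ys] by simp
qed (auto intro: eval.intros)

text \<open>One program has to serve all oracles with an empty query set, so that it can be built
  into oracle computations free of charge.\<close>

definition computable :: "nat \<Rightarrow> (nat list \<Rightarrow> nat) \<Rightarrow> bool" where
  "computable n F \<longleftrightarrow>
    (\<exists>p. oracle_free p \<and> (\<forall>B xs. length xs = n \<longrightarrow> eval B p xs (F xs) {}))"

lemma computable_cong:
  assumes "computable n F" "\<And>xs. length xs = n \<Longrightarrow> F xs = G xs"
  shows "computable n G"
  using assms unfolding computable_def by metis

lemma recursive_iff_computable: "recursive f \<longleftrightarrow> computable 1 (\<lambda>xs. f (xs ! 0))"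
proof
  assume "recursive f"
  then obtain p where p: "oracle_free p" "\<And>n. \<exists>Q. eval {} p [n] (f n) Q"
    unfolding recursive_def by blast
  have "eval B p xs (f (xs ! 0)) {}" if "length xs = 1" for B xs
  proof -
    from that obtain n where "xs = [n]" by (auto simp: length_Suc_conv)
    then show ?thesis using p oracle_free_eval by (metis nth_Cons_0)
  qed
  with p(1) show "computable 1 (\<lambda>xs. f (xs ! 0))" unfolding computable_def by blast
next
  assume "computable 1 (\<lambda>xs. f (xs ! 0))"
  then obtain p where p: "oracle_free p"
    "\<And>B xs. length xs = 1 \<Longrightarrow> eval B p xs (f (xs ! 0)) {}"
    unfolding computable_def by blast
  have "eval {} p [n] (f n) {}" for n using p(2)[of "[n]"] by simp
  with p(1) show "recursive f" unfolding recursive_def by blast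
qed

lemma computable_nth: "i < n \<Longrightarrow> computable n (\<lambda>xs. xs ! i)"
  unfolding computable_def by (rule exI[of _ "Proj i"]) (simp add: eval.Proj)

lemma computable_comp1:
  assumes "computable 1 (\<lambda>xs. f (xs ! 0))" "computable n G"
  shows "computable n (\<lambda>xs. f (G xs))"
proof -
  obtain p where p: "oracle_free p" "\<And>B xs. length xs = 1 \<Longrightarrow> eval B p xs (f (xs ! 0)) {}"
    using assms(1) unfolding computable_def by blast
  obtain q where q: "oracle_free q" "\<And>B xs. length xs = n \<Longrightarrow> eval B q xs (G xs) {}"
    using assms(2) unfolding computable_def by blast
  have "eval B (Comp p [q]) xs (f (G xs)) {}" if "length xs = n" for B xs
    using eval_Comp1[OF q(2)[OF that] p(2)[of "[G xs]"]] by simp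
  with p(1) q(1) show ?thesis
    unfolding computable_def by (intro exI[of _ "Comp p [q]"]) simp
qed

lemma computable_comp2:
  assumes "computable 2 (\<lambda>xs. f (xs ! 0) (xs ! 1))" "computable n G" "computable n H"
  shows "computable n (\<lambda>xs. f (G xs) (H xs))"
proof -
  obtain p where p: "oracle_free p"
    "\<And>B xs. length xs = 2 \<Longrightarrow> eval B p xs (f (xs ! 0) (xs ! 1)) {}"
    using assms(1) unfolding computable_def by blast
  obtain q where q: "oracle_free q" "\<And>B xs. length xs = n \<Longrightarrow> eval B q xs (G xs) {}"
    using assms(2) unfolding computable_def by blast
  obtain r where r: "oracle_free r" "\<And>B xs. length xs = n \<Longrightarrow> eval B r xs (H xs) {}"
    using assms(3) unfolding computable_def by blast
  have "eval B (Comp p [q, r]) xs (f (G xs) (H xs)) {}" if "length xs = n" for B xs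
    using eval_Comp2[OF q(2)[OF that] r(2)[OF that] p(2)[of "[G xs, H xs]"]] by simp
  with p(1) q(1) r(1) show ?thesis
    unfolding computable_def by (intro exI[of _ "Comp p [q, r]"]) simp
qed

lemma computable_recursive: "recursive f \<Longrightarrow> computable n G \<Longrightarrow> computable n (\<lambda>xs. f (G xs))"
  using computable_comp1 recursive_iff_computable by blast

lemma computable_Suc:
  assumes "computable n G"
  shows "computable n (\<lambda>xs. Suc (G xs))"
proof (rule computable_comp1[OF _ assms])
  have "eval B Succ xs (Suc (xs ! 0)) {}" if "length xs = 1" for B xs
    using that by (auto simp: length_Suc_conv eval.Succ)
  then show "computable 1 (\<lambda>xs. Suc (xs ! 0))"
    unfolding computable_def by (intro exI[of _ Succ]) simp
qed

lemma computable_const: "computable n (\<lambda>_. k)"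
proof (induction k)
  case 0
  show ?case unfolding computable_def by (rule exI[of _ Zero]) (simp add: eval.Zero)
next
  case (Suc k)
  then show ?case by (rule computable_Suc)
qed

lemma computable_rec_nat:
  assumes "computable n F" "computable (Suc (Suc n)) G"
  shows "computable (Suc n) (\<lambda>xs. rec_nat (F (tl xs)) (\<lambda>m y. G (m # y # tl xs)) (hd xs))"
proof -
  obtain p where p: "oracle_free p" "\<And>B xs. length xs = n \<Longrightarrow> eval B p xs (F xs) {}"
    using assms(1) unfolding computable_def by blast
  obtain q where q: "oracle_free q"
    "\<And>B xs. length xs = Suc (Suc n) \<Longrightarrow> eval B q xs (G xs) {}"
    using assms(2) unfolding computable_def by blast
  have *: "eval B (PrimRec p q) (k # xs) (rec_nat (F xs) (\<lambda>m y. G (m # y # xs)) k) {}"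
    if "length xs = n" for B xs k
  proof (induction k)
    case 0
    show ?case using p(2)[OF that] by (simp add: eval.PrimRec_0)
  next
    case (Suc k)
    show ?case
      using eval.PrimRec_Suc[OF Suc q(2)] that by simp
  qed
  have "eval B (PrimRec p q) xs (rec_nat (F (tl xs)) (\<lambda>m y. G (m # y # tl xs)) (hd xs)) {}"
    if "length xs = Suc n" for B xs
    using that * by (auto simp: length_Suc_conv)
  with p(1) q(1) show ?thesis
    unfolding computable_def by (intro exI[of _ "PrimRec p q"]) simp
qed

lemma computable_Least:
  assumes "computable (Suc n) F" "\<And>xs. length xs = n \<Longrightarrow> \<exists>q. F (q # xs) = 0"
  shows "computable n (\<lambda>xs. LEAST q. F (q # xs) = 0)"
proof -
  obtain p where p: "oracle_free p" "\<And>B xs. length xs = Suc n \<Longrightarrow> eval B p xs (F xs) {}"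
    using assms(1) unfolding computable_def by blast
  have "eval B (Mu p) xs (LEAST q. F (q # xs) = 0) {}" if "length xs = n" for B xs
  proof -
    define k where "k = (LEAST q. F (q # xs) = 0)"
    have "F (k # xs) = 0"
      unfolding k_def using assms(2)[OF that] by (rule LeastI_ex)
    moreover have "F (m # xs) = Suc (F (m # xs) - 1)" if "m < k" for m
      using not_less_Least[OF that[unfolded k_def]] by simp
    ultimately have "eval B (Mu p) xs k (\<Union>m\<le>k. {})"
      using p(2) that by (intro eval.Mu[of B p k xs _ "\<lambda>m. F (m # xs) - 1"]) (metis length_Cons)+
    then show ?thesis unfolding k_def by simp
  qed
  with p(1) show ?thesis
    unfolding computable_def by (intro exI[of _ "Mu p"]) simp
qed

text \<open>Argument 0 is the recursion variable and argument 1 a parameter. Addition,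
  multiplication, power and truncated subtraction are instances of this scheme.\<close>

lemma computable_rec_nat_param:
  assumes "computable 1 (\<lambda>xs. f (xs ! 0))" "computable 3 (\<lambda>xs. g (xs ! 0) (xs ! 1) (xs ! 2))"
  shows "computable 2 (\<lambda>xs. rec_nat (f (xs ! 1)) (\<lambda>m y. g m y (xs ! 1)) (xs ! 0))"
proof -
  have "computable (Suc 1) (\<lambda>xs. rec_nat (f (tl xs ! 0))
      (\<lambda>m y. g ((m # y # tl xs) ! 0) ((m # y # tl xs) ! 1) ((m # y # tl xs) ! 2)) (hd xs))"
    using assms by (intro computable_rec_nat) (simp_all add: numeral_3_eq_3)
  then show ?thesis
    unfolding Suc_1 by (rule computable_cong) (auto simp: length_Suc_conv numeral_2_eq_2)
qed

section \<open>Closure under arithmetic\<close>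

lemma computable_add:
  assumes "computable n G" "computable n H"
  shows "computable n (\<lambda>xs. G xs + H xs)"
proof (rule computable_comp2[OF _ assms])
  have "rec_nat b (\<lambda>_. Suc) a = a + b" for a b
    by (induction a) auto
  with computable_rec_nat_param[of "\<lambda>b. b" "\<lambda>_ y _. Suc y"]
  show "computable 2 (\<lambda>xs. xs ! 0 + xs ! 1)"
    by (simp add: computable_nth computable_Suc)
qed

lemma computable_mult:
  assumes "computable n G" "computable n H"
  shows "computable n (\<lambda>xs. G xs * H xs)"
proof (rule computable_comp2[OF _ assms])
  have "rec_nat 0 (\<lambda>_ y. y + b) a = a * b" for a b
    by (induction a) auto
  with computable_rec_nat_param[of "\<lambda>_. 0" "\<lambda>_ y b. y + b"]
  show "computable 2 (\<lambda>xs. xs ! 0 * xs ! 1)"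
    by (simp add: computable_nth computable_add computable_const)
qed

lemma computable_power:
  assumes "computable n G" "computable n H"
  shows "computable n (\<lambda>xs. G xs ^ H xs)"
\<comment> \<open>The operands are swapped because the recursion runs on the exponent, which
  therefore has to be argument 0.\<close>
proof (rule computable_comp2[OF _ assms(2,1)])
  have "rec_nat 1 (\<lambda>_ y. y * b) a = b ^ a" for a b :: nat
    by (induction a) auto
  with computable_rec_nat_param[of "\<lambda>_. 1" "\<lambda>_ y b. y * b"]
  show "computable 2 (\<lambda>xs. xs ! 1 ^ xs ! 0)"
    by (simp add: computable_nth computable_mult computable_const)
qed

lemma computable_diff:
  assumes "computable n G" "computable n H"
  shows "computable n (\<lambda>xs. G xs - H xs)"
proof (rule computable_comp2[OF _ assms(2,1)])
  \<comment> \<open>Predecessor: the recursion discards the previous value and returns its index.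
    Subtraction then iterates it.\<close>
  have "rec_nat 0 (\<lambda>m _. m) a = a - 1" for a
    by (cases a) auto
  with computable_rec_nat_param[of "\<lambda>_. 0" "\<lambda>m _ _. m"]
  have "computable 2 (\<lambda>xs. xs ! 0 - 1)"
    by (simp add: computable_nth computable_const)
  from computable_comp2[OF this] have pred: "computable n (\<lambda>xs. F xs - 1)"
    if "computable n F" for n F
    using that by blast
  have "rec_nat b (\<lambda>_ y. y - 1) a = b - a" for a b :: nat
    by (induction a) auto
  with computable_rec_nat_param[of "\<lambda>b. b" "\<lambda>_ y _. y - 1"]
  show "computable 2 (\<lambda>xs. xs ! 1 - xs ! 0)"
    by (simp add: computable_nth pred[simplified])
qed

lemma computable_less:
  assumes "computable n G" "computable n H"
  shows "computable n (\<lambda>xs. of_bool (G xs < H xs))"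
proof (rule computable_cong)
  show "computable n (\<lambda>xs. 1 - (1 - (H xs - G xs)))"
    using assms by (intro computable_diff computable_const)
qed auto

lemmas computable_arith = computable_nth computable_const computable_Suc computable_add
  computable_mult computable_power computable_diff computable_less

lemma computable_Least_less:
  assumes "computable (Suc n) F" "computable (Suc n) G"
    and "\<And>xs. length xs = n \<Longrightarrow> \<exists>q. F (q # xs) < G (q # xs)"
  shows "computable n (\<lambda>xs. LEAST q. F (q # xs) < G (q # xs))"
proof -
  have "computable n (\<lambda>xs. LEAST q. 1 - of_bool (F (q # xs) < G (q # xs)) = (0::nat))"
    using assms by (intro computable_Least computable_diff computable_const computable_less) auto
  moreover have "1 - of_bool P = (0::nat) \<longleftrightarrow> P" for P by simp
  ultimately show ?thesis by (simp only:)
qed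

lemma computable_div:
  assumes "computable n G" "computable n H" "\<And>xs. length xs = n \<Longrightarrow> H xs > 0"
  shows "computable n (\<lambda>xs. G xs div H xs)"
proof -
  have div_Least: "a div b = (LEAST q. a < Suc q * b)" if "b > 0" for a b :: nat
  proof (rule sym, rule Least_equality)
    show "a < Suc (a div b) * b"
      using that by (simp add: dividend_less_div_times)
    show "a div b \<le> q" if "a < Suc q * b" for q
      using that by (simp add: less_mult_imp_div_less less_Suc_eq_le[symmetric])
  qed
  \<comment> \<open>A zero divisor is replaced by 1 to make the search total.\<close>
  define F where "F a b = (LEAST q. a < Suc q * (b + (1 - b)))" for a b :: nat
  have "\<exists>q. a < Suc q * (b + (1 - b))" for a b :: nat
    by (rule exI[of _ a]) (cases b; simp)
  then have "computable 2 (\<lambda>xs. LEAST q. (q # xs) ! 1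
      < Suc ((q # xs) ! 0) * ((q # xs) ! 2 + (1 - (q # xs) ! 2)))"
    by (intro computable_Least_less computable_arith) auto
  then have "computable 2 (\<lambda>xs. F (xs ! 0) (xs ! 1))"
    by (simp add: F_def numeral_2_eq_2)
  then have "computable n (\<lambda>xs. F (G xs) (H xs))"
    by (rule computable_comp2[OF _ assms(1,2)])
  moreover have "F a b = a div b" if "b > 0" for a b
    using that div_Least[OF that] by (simp add: F_def)
  ultimately show ?thesis
    using assms(3) by (auto intro: computable_cong)
qed

section \<open>Strings as numbers\<close>

lemma str_code_Nil [simp]: "str_code [] = 1"
  by (simp add: str_code_def)

lemma str_code_snoc [simp]: "str_code (x @ [b]) = 2 * str_code x + of_bool b"
  by (simp add: str_code_def)

lemma str_code_bounds: "2 ^ length x \<le> str_code x" "str_code x < 2 ^ Suc (length x)"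
  by (induction x rule: rev_induct) auto

lemma str_code_pos [simp]: "0 < str_code x"
  using str_code_bounds(1)[of x] by (metis less_le_trans zero_less_numeral zero_less_power)

lemma str_code_inject [simp]: "str_code x = str_code y \<longleftrightarrow> x = y"
proof
  show "str_code x = str_code y \<Longrightarrow> x = y"
  proof (induction x arbitrary: y rule: rev_induct)
    case Nil
    show ?case
    proof (cases y rule: rev_cases)
      case (snoc z b)
      with Nil str_code_pos[of z] show ?thesis by simp
    qed simp
  next
    case (snoc b x)
    show ?case
    proof (cases y rule: rev_cases)
      case Nil
      with snoc.prems str_code_pos[of x] show ?thesis by simp
    next
      case (snoc z b')
      with snoc.prems have *: "2 * str_code x + of_bool b = 2 * str_code z + of_bool b'" by simp
      then have "b = b'" by (cases b; cases b'; simp; presburger)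
      moreover from this * have "str_code x = str_code z" by simp
      ultimately show ?thesis using snoc.IH \<open>y = z @ [b']\<close> by simp
    qed
  qed
qed simp

lemma str_code_surj: "c > 0 \<Longrightarrow> \<exists>x. str_code x = c"
proof (induction c rule: less_induct)
  case (less c)
  show ?case
  proof (cases "c = 1")
    case False
    with less have "c div 2 < c" "c div 2 > 0" by auto
    then obtain x where "str_code x = c div 2" using less.IH by blast
    then have "str_code (x @ [odd c]) = c" by (simp add: mult.commute)
    then show ?thesis by blast
  qed (use str_code_Nil in blast)
qed

lemma length_le_if_str_code_le: "str_code x \<le> str_code y \<Longrightarrow> length x \<le> length y"
proof (rule ccontr)
  assume "str_code x \<le> str_code y" "\<not> length x \<le> length y"
  moreover from this have "(2::nat) ^ Suc (length y) \<le> 2 ^ length x"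
    by (intro power_increasing) auto
  ultimately show False
    using str_code_bounds(1)[of x] str_code_bounds(2)[of y] by linarith
qed

text \<open>The leading 1 of the code of \<open>y\<close>, worth \<open>2 ^ length y\<close>, is
  lost in the concatenation. It is added on the left to avoid a truncated subtraction on the
  right.\<close>

lemma str_code_append: "str_code (x @ y) + 2 ^ length y = str_code x * 2 ^ length y + str_code y"
proof (induction y rule: rev_induct)
  case (snoc b y)
  have "str_code (x @ y @ [b]) = 2 * str_code (x @ y) + of_bool b"
    using str_code_snoc[of "x @ y" b] by simp
  with snoc show ?case by (simp add: algebra_simps)
qed simp

lemma str_code_replicate_False: "str_code (replicate i False) = 2 ^ i"
proof (induction i)
  case (Suc i)
  have "str_code (replicate (Suc i) False) = str_code (replicate i False @ [False])"
    by (simp add: replicate_append_same)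
  with Suc show ?case by simp
qed simp

text \<open>The zeros contribute nothing, and the marker \<open>True\<close> takes the place of the
  leading 1 of the code of \<open>x\<close>. Hence removing the top bit recovers \<open>x\<close>,
  whatever the number of zeros.\<close>

lemma str_code_pad:
  "str_code (replicate i False @ True # x) = 2 ^ (i + 1 + length x) + str_code x"
proof -
  have "str_code (replicate i False @ [True]) = 2 ^ Suc i + 1"
    by (simp add: str_code_replicate_False)
  then show ?thesis
    using str_code_append[of "replicate i False @ [True]" x] by (simp add: power_add algebra_simps)
qed

section \<open>Length, prefixes and bits computed from codes\<close>

text \<open>The position of the leading 1, for positive \<open>c\<close>, in the form that
  \<open>computable_Least_less\<close> handles.\<close>

definition code_length :: "nat \<Rightarrow> nat" where
  "code_length c = (LEAST l. c < 2 ^ Suc l)"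

text \<open>A right shift deletes the last bits. If \<open>n\<close> exceeds the length, the
  truncated exponent is 0 and the whole string is kept.\<close>

definition code_take :: "nat \<Rightarrow> nat \<Rightarrow> nat" where
  "code_take n c = c div 2 ^ (code_length c - n)"

text \<open>Appending bit \<open>i\<close> doubles the code of the prefix of length \<open>i\<close>
  and adds the bit, so the difference isolates it.\<close>

definition code_nth :: "nat \<Rightarrow> nat \<Rightarrow> nat" where
  "code_nth c i = code_take (Suc i) c - 2 * code_take i c"

lemma code_length_str_code [simp]: "code_length (str_code x) = length x"
  unfolding code_length_def
proof (rule Least_equality)
  show "length x \<le> l" if "str_code x < 2 ^ Suc l" for l
  proof -
    have "(2::nat) ^ length x < 2 ^ Suc l"
      using str_code_bounds(1) that by (rule le_less_trans)
    then have "length x < Suc l" by (simp only: power_strict_increasing_iff)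
    then show ?thesis by simp
  qed
qed (rule str_code_bounds)

lemma code_take_str_code [simp]: "code_take n (str_code x) = str_code (take n x)"
proof -
  let ?y = "drop n x"
  have "str_code x + 2 ^ length ?y = str_code (take n x) * 2 ^ length ?y + str_code ?y"
    using str_code_append[of "take n x" ?y] by simp
  with str_code_bounds[of ?y]
  have "str_code x div 2 ^ length ?y = str_code (take n x)"
    by (intro div_nat_eqI) (auto simp: algebra_simps)
  then show ?thesis by (simp add: code_take_def)
qed

lemma code_nth_str_code [simp]: "i < length x \<Longrightarrow> code_nth (str_code x) i = of_bool (x ! i)"
  by (simp add: code_nth_def take_Suc_conv_app_nth)

lemma computable_code_length:
  assumes "computable n G"
  shows "computable n (\<lambda>xs. code_length (G xs))"
proof (rule computable_comp1[OF _ assms])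
  have "computable 1 (\<lambda>xs. LEAST l. (l # xs) ! 1 < 2 ^ Suc ((l # xs) ! 0))"
  proof (intro computable_Least_less computable_arith)
    show "\<exists>l. (l # xs) ! 1 < 2 ^ Suc ((l # xs) ! 0)" for xs :: "nat list"
    proof -
      have "xs ! 0 < 2 * 2 ^ (xs ! 0)" using less_exp[of "xs ! 0"] by linarith
      then show ?thesis by auto
    qed
  qed auto
  then show "computable 1 (\<lambda>xs. code_length (xs ! 0))"
    by (simp add: code_length_def)
qed

lemma computable_code_take:
  "computable n G \<Longrightarrow> computable n H \<Longrightarrow> computable n (\<lambda>xs. code_take (G xs) (H xs))"
  unfolding code_take_def
  by (intro computable_div computable_power computable_diff computable_const computable_code_length)
    auto

lemma computable_code_nth:
  "computable n G \<Longrightarrow> computable n H \<Longrightarrow> computable n (\<lambda>xs. code_nth (G xs) (H xs))"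
  unfolding code_nth_def
  by (intro computable_diff computable_mult computable_const computable_code_take computable_Suc)

lemma length_initial_segment [simp]: "length (A \<restriction> n) = n"
  by (simp add: initial_segment_def)

lemma nth_initial_segment [simp]: "i < n \<Longrightarrow> (A \<restriction> n) ! i \<longleftrightarrow> i \<in> A"
  by (simp add: initial_segment_def)

lemma initial_segment_Suc: "A \<restriction> Suc n = A \<restriction> n @ [n \<in> A]"
  by (simp add: initial_segment_def)

lemma take_initial_segment: "m \<le> n \<Longrightarrow> take m (A \<restriction> n) = A \<restriction> m"
  by (simp add: initial_segment_def take_map)

section \<open>Complexity\<close>

text \<open>A finite bound rules out the empty set of descriptions, and in the well-order
  \<open>enat\<close> the infimum of a nonempty set is attained.\<close>

lemma complexity_le_iff: "complexity M \<sigma> \<le> enat k \<longleftrightarrow> (\<exists>\<tau>. M \<tau> = Some \<sigma> \<and> length \<tau> \<le> k)"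
proof
  assume *: "complexity M \<sigma> \<le> enat k"
  then have "(\<lambda>\<tau>. enat (length \<tau>)) ` {\<tau>. M \<tau> = Some \<sigma>} \<noteq> {}"
    unfolding complexity_def by (metis enat_ord_code(5) Inf_empty top_enat_def)
  then have "complexity M \<sigma> \<in> (\<lambda>\<tau>. enat (length \<tau>)) ` {\<tau>. M \<tau> = Some \<sigma>}"
    unfolding complexity_def by (metis ex_in_conv wellorder_InfI)
  with * show "\<exists>\<tau>. M \<tau> = Some \<sigma> \<and> length \<tau> \<le> k" by auto
next
  assume "\<exists>\<tau>. M \<tau> = Some \<sigma> \<and> length \<tau> \<le> k"
  then show "complexity M \<sigma> \<le> enat k"
    unfolding complexity_def by (auto intro: INF_lower2)
qed

text \<open>
  An arbitrary program becomes a machine once its outputs are replaced by their maximum with 1,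
  since 0 is the only number that is not the code of a string.
\<close>

lemma complexity_le_of_program:
  assumes "optimal U" "oracle_free q"
  shows "\<exists>c. \<forall>\<sigma> \<tau> Q. eval {} q [str_code \<sigma>] (str_code \<tau>) Q
    \<longrightarrow> complexity U \<tau> \<le> enat (length \<sigma> + c)"
proof -
  have "computable 1 (\<lambda>xs. xs ! 0 + (1 - xs ! 0))"
    by (intro computable_arith) auto
  then obtain r where r: "oracle_free r"
    "\<And>B xs. length xs = 1 \<Longrightarrow> eval B r xs (xs ! 0 + (1 - xs ! 0)) {}"
    unfolding computable_def by blast
  let ?p = "Comp r [q]"
  define M where "M \<sigma> = (if \<exists>\<tau> Q. eval {} ?p [str_code \<sigma>] (str_code \<tau>) Q
    then Some (SOME \<tau>. \<exists>Q. eval {} ?p [str_code \<sigma>] (str_code \<tau>) Q) else None)" for \<sigma>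
  have M_iff: "M \<sigma> = Some \<tau> \<longleftrightarrow> (\<exists>Q. eval {} ?p [str_code \<sigma>] (str_code \<tau>) Q)" for \<sigma> \<tau>
  proof -
    \<comment> \<open>Determinism leaves only one possible output, so the choice in the definition
      of \<open>M\<close> is forced.\<close>
    have "\<tau>' = \<tau>" if "eval {} ?p [str_code \<sigma>] (str_code \<tau>) Q"
      "eval {} ?p [str_code \<sigma>] (str_code \<tau>') Q'" for \<tau> \<tau>' Q Q'
      using eval_deterministic[OF that] by simp
    then have "(SOME \<tau>. \<exists>Q. eval {} ?p [str_code \<sigma>] (str_code \<tau>) Q) = \<tau>"
      if "\<exists>Q. eval {} ?p [str_code \<sigma>] (str_code \<tau>) Q" for \<tau>
      using that by (intro some_equality) blast+
    moreover have "\<exists>Q. eval {} ?p [str_code \<sigma>]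
        (str_code (SOME \<tau>. \<exists>Q. eval {} ?p [str_code \<sigma>] (str_code \<tau>) Q)) Q"
      if "\<exists>\<tau> Q. eval {} ?p [str_code \<sigma>] (str_code \<tau>) Q"
      using that by (rule someI_ex)
    ultimately show ?thesis unfolding M_def by auto
  qed
  have "y > 0" if p: "eval {} ?p [str_code \<sigma>] y Q" for \<sigma> y Q
  proof -
    from p obtain ys R where "length ys = length [q]" "eval {} r ys y R"
      by (auto elim: eval_CompE)
    then have "y = ys ! 0 + (1 - ys ! 0)"
      using eval_deterministic r(2) by (metis One_nat_def length_Cons list.size(3))
    then show "y > 0" by auto
  qed
  then have "(\<exists>Q. eval {} ?p [str_code \<sigma>] y Q) \<longleftrightarrow> (\<exists>\<tau>. M \<sigma> = Some \<tau> \<and> y = str_code \<tau>)" for \<sigma> y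
    unfolding M_iff using str_code_surj by blast
  then have "partial_recursive M"
    unfolding partial_recursive_def using assms(2) r(1) by (intro exI[of _ ?p]) auto
  then obtain c where c: "\<And>\<tau>. complexity U \<tau> \<le> complexity M \<tau> + enat c"
    using assms(1) unfolding optimal_def by blast
  show ?thesis
  proof (intro exI allI impI)
    fix \<sigma> \<tau> Q
    assume "eval {} q [str_code \<sigma>] (str_code \<tau>) Q"
    moreover have "eval {} r [str_code \<tau>] (str_code \<tau>) {}"
      using r(2)[of "[str_code \<tau>]"] str_code_pos[of \<tau>] by (simp add: Suc_leI)
    ultimately have "M \<sigma> = Some \<tau>"
      unfolding M_iff using eval_Comp1 by blast
    then have "complexity M \<tau> \<le> enat (length \<sigma>)"
      unfolding complexity_le_iff by blast
    with c[of \<tau>] show "complexity U \<tau> \<le> enat (length \<sigma> + c)"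
      by (metis add_right_mono order_trans plus_enat_simps(1))
  qed
qed

text \<open>The identity program describes every string by itself.\<close>

lemma complexity_finite: "optimal U \<Longrightarrow> \<exists>k. complexity U \<tau> \<le> enat k"
proof -
  assume "optimal U"
  then obtain c where "\<And>\<sigma> \<tau> Q. eval {} (Proj 0) [str_code \<sigma>] (str_code \<tau>) Q
      \<Longrightarrow> complexity U \<tau> \<le> enat (length \<sigma> + c)"
    using complexity_le_of_program[of U "Proj 0"] by auto
  then show ?thesis using eval_Proj[of 0 "[str_code \<tau>]"] by fastforce
qed

lemma optimal_program:
  assumes "optimal U"
  shows "\<exists>p. oracle_free p
    \<and> (\<forall>B \<sigma> \<tau>. U \<sigma> = Some \<tau> \<longrightarrow> eval B p [str_code \<sigma>] (str_code \<tau>) {})"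
proof -
  obtain p where p: "oracle_free p"
    "\<forall>\<sigma> y. (\<exists>Q. eval {} p [str_code \<sigma>] y Q) \<longleftrightarrow> (\<exists>\<tau>. U \<sigma> = Some \<tau> \<and> y = str_code \<tau>)"
    using assms unfolding optimal_def partial_recursive_def by blast
  then have "eval B p [str_code \<sigma>] (str_code \<tau>) {}" if "U \<sigma> = Some \<tau>" for B \<sigma> \<tau>
    using that oracle_free_eval by metis
  with p(1) show ?thesis by blast
qed

lemma shortest_description:
  assumes "optimal U"
  shows "U (shortest_description U x) = Some x"
    and "complexity U x \<le> enat k \<Longrightarrow> length (shortest_description U x) \<le> k"
proof -
  obtain \<tau> where \<tau>: "U \<tau> = Some x"
    using complexity_finite[OF assms] unfolding complexity_le_iff by blast
  then show "U (shortest_description U x) = Some x"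
    unfolding shortest_description_def by (rule arg_min_natI)
  have least: "str_code (shortest_description U x) \<le> str_code \<sigma>" if "U \<sigma> = Some x" for \<sigma>
    unfolding shortest_description_def using that by (rule arg_min_nat_le)
  show "length (shortest_description U x) \<le> k" if "complexity U x \<le> enat k"
  proof -
    obtain \<sigma> where "U \<sigma> = Some x" "length \<sigma> \<le> k"
      using \<open>complexity U x \<le> enat k\<close> unfolding complexity_le_iff by blast
    then show ?thesis using length_le_if_str_code_le[OF least] le_trans by blast
  qed
qed

section \<open>The function \<open>g_fun\<close> and the complexity of its segments\<close>

text \<open>There are finitely many descriptions of length at most \<open>k\<close>, and initial
  segments of different lengths are different strings.\<close>

lemma finite_low_complexity: "finite {n. complexity U (A \<restriction> n) \<le> enat k}"
proof (rule finite_imageD)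
  have "(\<lambda>n. A \<restriction> n) ` {n. complexity U (A \<restriction> n) \<le> enat k}
      \<subseteq> (\<lambda>\<tau>. the (U \<tau>)) ` {\<tau>. set \<tau> \<subseteq> UNIV \<and> length \<tau> \<le> k}"
    unfolding complexity_le_iff by force
  then show "finite ((\<lambda>n. A \<restriction> n) ` {n. complexity U (A \<restriction> n) \<le> enat k})"
    by (rule finite_subset) (intro finite_imageI finite_lists_length_le, simp)
  show "inj_on (\<lambda>n. A \<restriction> n) {n. complexity U (A \<restriction> n) \<le> enat k}"
    by (rule inj_onI) (metis length_initial_segment)
qed

text \<open>Finiteness of the set of low-complexity segments guarantees that the
  \<open>LEAST\<close> in \<open>g_fun\<close> exists.\<close>

lemma g_fun_le: "g_fun U A k \<le> m \<Longrightarrow> enat k < complexity U (A \<restriction> m)"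
proof -
  obtain n where "\<forall>m\<in>{m. complexity U (A \<restriction> m) \<le> enat k}. m < n"
    using finite_low_complexity[of U A k] finite_nat_set_iff_bounded by blast
  then have "\<exists>n. \<forall>m\<ge>n. enat k < complexity U (A \<restriction> m)"
    by (intro exI[of _ n]) (metis mem_Collect_eq not_less)
  then have "\<forall>m\<ge>g_fun U A k. enat k < complexity U (A \<restriction> m)"
    unfolding g_fun_def by (rule LeastI_ex)
  then show "g_fun U A k \<le> m \<Longrightarrow> enat k < complexity U (A \<restriction> m)" by blast
qed

lemma less_g_fun: "complexity U (A \<restriction> n) \<le> enat k \<Longrightarrow> n < g_fun U A k"
  using g_fun_le[of U A k n] by (meson not_le)

lemma g_fun_eq_Suc: "g_fun U A k = Suc n \<Longrightarrow> complexity U (A \<restriction> n) \<le> enat k"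
proof (rule ccontr)
  assume *: "g_fun U A k = Suc n" "\<not> complexity U (A \<restriction> n) \<le> enat k"
  then have "\<forall>m\<ge>n. enat k < complexity U (A \<restriction> m)"
    using g_fun_le[of U A k] by (metis not_le not_less_eq_eq le_antisym)
  then have "g_fun U A k \<le> n" unfolding g_fun_def by (rule Least_le)
  with *(1) show False by simp
qed

text \<open>The segment one bit shorter has complexity at most \<open>k\<close>, and the missing bit
  is supplied by appending it to a description.\<close>

lemma complexity_g_fun:
  assumes "optimal U"
  shows "\<exists>c. \<forall>k. complexity U (A \<restriction> g_fun U A k) \<le> enat (k + c)"
proof -
  obtain p where p: "oracle_free p"
    "\<And>B \<sigma> \<tau>. U \<sigma> = Some \<tau> \<Longrightarrow> eval B p [str_code \<sigma>] (str_code \<tau>) {}"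
    using optimal_program[OF assms] by blast
  \<comment> \<open>\<open>h\<close> deletes the last bit of a code; \<open>r\<close> below appends
    the last bit of its second argument to its first.\<close>
  have "computable 1 (\<lambda>xs. xs ! 0 div 2)"
    by (intro computable_div computable_arith) auto
  then obtain h where h: "oracle_free h"
    "\<And>B xs. length xs = 1 \<Longrightarrow> eval B h xs (xs ! 0 div 2) {}"
    unfolding computable_def by blast
  have "computable 2 (\<lambda>xs. 2 * xs ! 0 + (xs ! 1 - 2 * (xs ! 1 div 2)))"
    by (intro computable_div computable_arith) auto
  then obtain r where r: "oracle_free r"
    "\<And>B xs. length xs = 2 \<Longrightarrow> eval B r xs (2 * xs ! 0 + (xs ! 1 - 2 * (xs ! 1 div 2))) {}"
    unfolding computable_def by blast
  \<comment> \<open>This program maps \<open>\<sigma>b\<close> to \<open>U(\<sigma>)b\<close>.\<close>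
  let ?q = "Comp r [Comp p [h], Proj 0]"
  have "oracle_free ?q" using p(1) h(1) r(1) by simp
  obtain c where c: "\<And>\<sigma> \<tau> Q. eval {} ?q [str_code \<sigma>] (str_code \<tau>) Q
      \<Longrightarrow> complexity U \<tau> \<le> enat (length \<sigma> + c)"
    using complexity_le_of_program[OF assms \<open>oracle_free ?q\<close>] by blast
  have snoc: "complexity U (\<tau> @ [b]) \<le> enat (Suc (length \<sigma>) + c)" if "U \<sigma> = Some \<tau>" for \<sigma> \<tau> b
  proof -
    let ?x = "[str_code (\<sigma> @ [b])]"
    have "eval {} h ?x (str_code \<sigma>) {}"
      using h(2)[of ?x] by simp
    then have "eval {} (Comp p [h]) ?x (str_code \<tau>) ({} \<union> {})"
      using p(2)[OF that] by (rule eval_Comp1)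
    moreover have "eval {} (Proj 0) ?x (hd ?x) {}"
      by (rule eval_Proj) auto
    moreover have "eval {} r [str_code \<tau>, hd ?x] (str_code (\<tau> @ [b])) {}"
      using r(2)[of "[str_code \<tau>, hd ?x]"] by simp
    ultimately have "eval {} ?q ?x (str_code (\<tau> @ [b])) ({} \<union> {} \<union> {} \<union> {})"
      by (rule eval_Comp2)
    from c[OF this] show ?thesis by simp
  qed
  obtain d where d: "complexity U (A \<restriction> 0) \<le> enat d"
    using complexity_finite[OF assms] by blast
  show ?thesis
  proof (intro exI allI)
    fix k
    show "complexity U (A \<restriction> g_fun U A k) \<le> enat (k + (d + Suc c))"
    proof (cases "g_fun U A k")
      \<comment> \<open>There is no shorter segment here; the constant \<open>d\<close> covers the
        empty string.\<close>
      case 0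
      with d show ?thesis by (metis add.commute add.assoc enat_ord_simps(1) le_add1 order_trans)
    next
      case (Suc n)
      from g_fun_eq_Suc[OF this] obtain \<sigma> where "U \<sigma> = Some (A \<restriction> n)" "length \<sigma> \<le> k"
        unfolding complexity_le_iff by blast
      then have "complexity U (A \<restriction> Suc n) \<le> enat (Suc (length \<sigma>) + c)"
        using snoc initial_segment_Suc by metis
      also have "\<dots> \<le> enat (k + (d + Suc c))" using \<open>length \<sigma> \<le> k\<close> by simp
      finally show ?thesis using Suc by simp
    qed
  qed
qed

section \<open>Anti-complexity\<close>

lemma recursive_order_function: "order_function f \<Longrightarrow> recursive f"
  by (simp add: order_function_def)

lemma order_function_affine:
  assumes "order_function f"
  shows "order_function (\<lambda>n. f (2 * n + b))"
  unfolding order_function_def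
proof (intro conjI allI)
  show "recursive (\<lambda>n. f (2 * n + b))"
    unfolding recursive_iff_computable
    by (intro computable_recursive[OF recursive_order_function[OF assms]] computable_arith) auto
  have f: "mono f" "\<forall>b. \<exists>n. b \<le> f n" using assms by (auto simp: order_function_def)
  show "mono (\<lambda>n. f (2 * n + b))"
    using f(1) by (intro monoI) (auto elim: monoD)
  show "\<exists>n. d \<le> f (2 * n + b)" for d
  proof -
    obtain n where "d \<le> f n" using f(2) by blast
    also have "f n \<le> f (2 * n + b)" using f(1) by (rule monoD) simp
    finally show ?thesis by blast
  qed
qed

text \<open>
  The constant is removed by passing from \<open>f\<close> to \<open>f(2n)\<close> and \<open>f(2n+1)\<close>, which turns the
  bound \<open>n + c\<close> into \<open>n/2 + c\<close>.
\<close>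

lemma anti_complexI:
  assumes "\<And>f. order_function f \<Longrightarrow> \<exists>c. \<forall>\<^sub>\<infinity>n. complexity U (A \<restriction> f n) \<le> enat (n + c)"
  shows "anti_complex U A"
  unfolding anti_complex_def
proof (intro allI impI)
  fix f assume f: "order_function f"
  have half: "\<exists>N. \<forall>n\<ge>N. complexity U (A \<restriction> f (2 * n + b)) \<le> enat (2 * n)" for b
  proof -
    obtain c N where *: "\<forall>n\<ge>N. complexity U (A \<restriction> f (2 * n + b)) \<le> enat (n + c)"
      using assms[OF order_function_affine[OF f, of b]] unfolding MOST_nat_le by blast
    have "complexity U (A \<restriction> f (2 * n + b)) \<le> enat (2 * n)" if "n \<ge> max N c" for n
    proof -
      have "complexity U (A \<restriction> f (2 * n + b)) \<le> enat (n + c)" using * that by simp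
      also have "\<dots> \<le> enat (2 * n)" using that by simp
      finally show ?thesis .
    qed
    then show ?thesis by blast
  qed
  obtain N0 where N0: "\<And>n. n \<ge> N0 \<Longrightarrow> complexity U (A \<restriction> f (2 * n + 0)) \<le> enat (2 * n)"
    using half[of 0] by blast
  obtain N1 where N1: "\<And>n. n \<ge> N1 \<Longrightarrow> complexity U (A \<restriction> f (2 * n + 1)) \<le> enat (2 * n)"
    using half[of 1] by blast
  have "complexity U (A \<restriction> f n) \<le> enat n" if "n \<ge> 2 * (N0 + N1)" for n
  proof (cases "even n")
    case True
    then obtain m where m: "n = 2 * m" by (elim evenE)
    with that N0[of m] show ?thesis by simp
  next
    case False
    then obtain m where m: "n = 2 * m + 1" by (elim oddE)
    with that have "complexity U (A \<restriction> f n) \<le> enat (2 * m)" using N1[of m] by simp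
    also have "\<dots> \<le> enat n" using m by simp
    finally show ?thesis .
  qed
  then show "\<forall>\<^sub>\<infinity>n. complexity U (A \<restriction> f n) \<le> enat n"
    unfolding MOST_nat_le by blast
qed

section \<open>Anti-complexity and dominance of \<open>g_fun\<close>\<close>

text \<open>Take partial sums of \<open>g + 1\<close>: the summand 1 makes them unbounded, and the
  shift to \<open>s (Suc n)\<close> includes \<open>g n\<close>. This bridges dominance, which
  concerns all recursive functions, and anti-complexity, which concerns order functions.\<close>

lemma order_function_majorant:
  assumes "recursive g"
  shows "\<exists>h. order_function h \<and> (\<forall>n. g n \<le> h n)"
proof -
  define s where "s k = rec_nat 0 (\<lambda>m y. Suc (y + g m)) k" for k
  have s_Suc: "s (Suc k) = Suc (s k + g k)" for k by (simp add: s_def)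
  have "computable (Suc 0) (\<lambda>xs. rec_nat ((\<lambda>_. 0) (tl xs))
      (\<lambda>m y. (\<lambda>ys. Suc (ys ! 1 + g (ys ! 0))) (m # y # tl xs)) (hd xs))"
    by (intro computable_rec_nat computable_recursive[OF assms] computable_arith) auto
  then have "computable 1 (\<lambda>xs. s (xs ! 0))"
    unfolding One_nat_def by (rule computable_cong) (auto simp: s_def length_Suc_conv)
  from computable_comp1[OF this, of 1 "\<lambda>xs. Suc (xs ! 0)"]
  have "recursive (\<lambda>n. s (Suc n))"
    unfolding recursive_iff_computable by (simp add: computable_Suc computable_nth)
  moreover have "mono (\<lambda>n. s (Suc n))"
    by (rule mono_iff_le_Suc[THEN iffD2]) (simp add: s_Suc)
  moreover have "n \<le> s n" for n by (induction n) (auto simp: s_Suc)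
  ultimately have "order_function (\<lambda>n. s (Suc n))"
    unfolding order_function_def by (metis le_Suc_eq s_Suc le_add1 le_trans)
  moreover have "g n \<le> s (Suc n)" for n by (simp add: s_Suc)
  ultimately show ?thesis by blast
qed

lemma anti_complex_imp_dominant:
  assumes "anti_complex U A"
  shows "dominant (g_fun U A)"
  unfolding dominant_def dominates_def
proof (intro allI impI)
  fix g assume "recursive g"
  then obtain h where h: "order_function h" "\<And>n. g n \<le> h n"
    using order_function_majorant by blast
  then have "\<forall>\<^sub>\<infinity>n. complexity U (A \<restriction> h n) \<le> enat n"
    using assms by (simp add: anti_complex_def)
  then show "\<forall>\<^sub>\<infinity>n. g n \<le> g_fun U A n"
    by (rule MOST_mono) (use h(2) less_g_fun le_trans less_imp_le in blast)
qed

lemma dominant_imp_anti_complex: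
  assumes "optimal U" "dominant (g_fun U A)"
  shows "anti_complex U A"
proof (rule anti_complexI)
  fix f assume f: "order_function f"
  then have rec: "recursive f" by (rule recursive_order_function)
  obtain p where p: "oracle_free p"
    "\<And>B \<sigma> \<tau>. U \<sigma> = Some \<tau> \<Longrightarrow> eval B p [str_code \<sigma>] (str_code \<tau>) {}"
    using optimal_program[OF assms(1)] by blast
  \<comment> \<open>\<open>s\<close> removes the top bit of a code and so undoes the
    padding.\<close>
  have "computable 1 (\<lambda>xs. xs ! 0 - 2 ^ code_length (xs ! 0))"
    by (intro computable_arith computable_code_length) auto
  then obtain s where s: "oracle_free s"
    "\<And>B xs. length xs = 1 \<Longrightarrow> eval B s xs (xs ! 0 - 2 ^ code_length (xs ! 0)) {}"
    unfolding computable_def by blast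
  have "computable 2 (\<lambda>xs. code_take (f (code_length (xs ! 1))) (xs ! 0))"
    by (intro computable_code_take computable_recursive[OF rec] computable_code_length computable_nth)
      auto
  then obtain t where t: "oracle_free t"
    "\<And>B xs. length xs = 2 \<Longrightarrow> eval B t xs (code_take (f (code_length (xs ! 1))) (xs ! 0)) {}"
    unfolding computable_def by blast
  \<comment> \<open>The program maps \<open>0\<dots>01\<tau>\<close> of length \<open>n\<close> to the first \<open>f(n)\<close> bits of \<open>U(\<tau>)\<close>.\<close>
  let ?q = "Comp t [Comp p [s], Proj 0]"
  have "oracle_free ?q" using p(1) s(1) t(1) by simp
  obtain c where c: "\<And>\<sigma> \<tau> Q. eval {} ?q [str_code \<sigma>] (str_code \<tau>) Q
      \<Longrightarrow> complexity U \<tau> \<le> enat (length \<sigma> + c)"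
    using complexity_le_of_program[OF assms(1) \<open>oracle_free ?q\<close>] by blast
  \<comment> \<open>The outer \<open>Suc\<close> makes \<open>g_fun U A k\<close> positive, so that
    it has a predecessor \<open>m\<close>, still at least \<open>f (Suc k)\<close>, whose segment
    has complexity at most \<open>k\<close>.\<close>
  have "recursive (\<lambda>k. Suc (f (Suc k)))"
    unfolding recursive_iff_computable
    by (intro computable_Suc computable_recursive[OF rec] computable_nth) auto
  then obtain N where N: "\<And>k. k \<ge> N \<Longrightarrow> Suc (f (Suc k)) \<le> g_fun U A k"
    using assms(2) unfolding dominant_def dominates_def MOST_nat_le by blast
  have "complexity U (A \<restriction> f n) \<le> enat (n + c)" if "n \<ge> Suc N" for n
  proof -
    obtain k where k: "n = Suc k" "k \<ge> N" using \<open>n \<ge> Suc N\<close> Suc_le_D by force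
    then obtain m where m: "g_fun U A k = Suc m" "f n \<le> m"
      using N[of k] by (cases "g_fun U A k") auto
    from g_fun_eq_Suc[OF m(1)] obtain \<tau> where \<tau>: "U \<tau> = Some (A \<restriction> m)" "length \<tau> \<le> k"
      unfolding complexity_le_iff by blast
    \<comment> \<open>The marker costs one bit, so every description of length at most
      \<open>k\<close> can be padded to length exactly \<open>Suc k\<close>.\<close>
    let ?\<sigma> = "replicate (k - length \<tau>) False @ True # \<tau>"
    let ?x = "[str_code ?\<sigma>]"
    have len: "length ?\<sigma> = n" using \<tau>(2) k(1) by simp
    have "str_code ?\<sigma> - 2 ^ code_length (str_code ?\<sigma>) = str_code \<tau>"
      unfolding code_length_str_code len using \<tau>(2) k(1) by (simp add: str_code_pad)
    then have "eval {} s ?x (str_code \<tau>) {}"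
      using s(2)[of ?x] by simp
    then have "eval {} (Comp p [s]) ?x (str_code (A \<restriction> m)) ({} \<union> {})"
      using p(2)[OF \<tau>(1)] by (rule eval_Comp1)
    moreover have "eval {} (Proj 0) ?x (str_code ?\<sigma>) {}"
      by (rule eval_Proj) auto
    moreover have "eval {} t [str_code (A \<restriction> m), str_code ?\<sigma>] (str_code (A \<restriction> f n)) {}"
      using t(2)[of "[str_code (A \<restriction> m), str_code ?\<sigma>]"] m(2) len
      by (simp add: take_initial_segment del: length_append)
    ultimately have "eval {} ?q ?x (str_code (A \<restriction> f n)) ({} \<union> {} \<union> {} \<union> {})"
      by (rule eval_Comp2)
    from c[OF this] show ?thesis unfolding len .
  qed
  then show "\<exists>c. \<forall>\<^sub>\<infinity>n. complexity U (A \<restriction> f n) \<le> enat (n + c)"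
    unfolding MOST_nat_le by blast
qed

section \<open>Finite oracles as inputs\<close>

text \<open>
  The oracle becomes an additional last argument of the program, so the position of that argument
  depends on the number \<open>n\<close> of the original arguments.
\<close>

fun subst_oracle :: "prog \<Rightarrow> nat \<Rightarrow> prog \<Rightarrow> prog" where
  "subst_oracle l n Zero = Zero"
| "subst_oracle l n Succ = Comp Succ [Proj 0]"
| "subst_oracle l n (Proj i) = Proj i"
| "subst_oracle l n Query = l"
| "subst_oracle l n (Comp f gs) =
    Comp (subst_oracle l (length gs) f) (map (subst_oracle l n) gs @ [Proj n])"
| "subst_oracle l n (PrimRec f g) = PrimRec (subst_oracle l (n - 1) f) (subst_oracle l (Suc n) g)"
| "subst_oracle l n (Mu f) = Mu (subst_oracle l (Suc n) f)"

lemma oracle_free_subst_oracle: "oracle_free l \<Longrightarrow> oracle_free (subst_oracle l n p)"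
  by (induction p arbitrary: n) auto

text \<open>Only the answers on \<open>Q\<close> influence the computation, so \<open>c\<close> has
  to describe \<open>B\<close> only there. In a composition, the added \<open>Proj\<close> hands
  \<open>c\<close> on to the outer program.\<close>

lemma eval_subst_oracle:
  assumes "eval B p xs y Q" "\<And>x. x \<in> Q \<Longrightarrow> eval B' l [x, c] (of_bool (x \<in> B)) {}"
  shows "eval B' (subst_oracle l (length xs) p) (xs @ [c]) y {}"
  using assms
proof (induction rule: eval.induct)
  case (Zero xs)
  show ?case by (simp add: eval.Zero)
next
  case (Succ x)
  show ?case using eval_Comp1[OF eval_Proj[of 0 "[x, c]"] eval.Succ] by simp
next
  case (Proj i xs)
  then show ?case by (simp add: eval_Proj nth_append)
next
  case (Query x)
  then show ?case by simp
next
  case (Comp ys gs xs Qs f z R)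
  have "eval B' (map (subst_oracle l (length xs)) gs ! i) (xs @ [c]) (ys ! i) {}"
    if "i < length gs" for i
    using Comp.IH(1) Comp.prems that by auto
  then have "\<forall>i<length (map (subst_oracle l (length xs)) gs @ [Proj (length xs)]).
      eval B' ((map (subst_oracle l (length xs)) gs @ [Proj (length xs)]) ! i) (xs @ [c])
        ((ys @ [c]) ! i) {}"
    using Comp.hyps(1) by (auto simp: nth_append less_Suc_eq intro!: eval_Proj)
  moreover have "eval B' (subst_oracle l (length gs) f) (ys @ [c]) z {}"
    using Comp.IH(2) Comp.prems Comp.hyps(1) by simp
  ultimately show ?case
    using Comp.hyps(1) eval.Comp[of "ys @ [c]" "map (subst_oracle l (length xs)) gs @ [Proj (length xs)]"
        B' "xs @ [c]" "\<lambda>_. {}" _ z "{}"] by simp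
next
  case (PrimRec_0 f xs z Q g)
  then show ?case by (simp add: eval.PrimRec_0)
next
  case (PrimRec_Suc f g n xs y Q z R)
  then have "eval B' (PrimRec (subst_oracle l (length xs) f) (subst_oracle l (Suc (Suc (length xs))) g))
      (n # xs @ [c]) y {}"
    "eval B' (subst_oracle l (Suc (Suc (length xs))) g) (n # y # xs @ [c]) z {}"
    by simp_all
  from eval.PrimRec_Suc[OF this] show ?case by simp
next
  case (Mu f n xs Qs ys)
  have "eval B' (subst_oracle l (Suc (length xs)) f) (n # xs @ [c]) 0 {}"
    using Mu.IH(1) Mu.prems by auto
  moreover have "eval B' (subst_oracle l (Suc (length xs)) f) (m # xs @ [c]) (Suc (ys m)) {}"
    if "m < n" for m
  proof -
    have "x \<in> Qs m \<Longrightarrow> eval B' l [x, c] (of_bool (x \<in> B)) {}" for x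
      using Mu.prems[of x] less_imp_le[OF that] by blast
    then show ?thesis using Mu.IH(2) that by simp
  qed
  ultimately show ?case
    using eval.Mu[of B' "subst_oracle l (Suc (length xs)) f" n "xs @ [c]" "\<lambda>_. {}" ys] by simp
qed

section \<open>Reductions with bounded use\<close>

lemma queries_eq: "eval B p [n] y Q \<Longrightarrow> queries p B n = Q"
  unfolding queries_def using eval_deterministic by blast

lemma finite_queries: "finite (queries p B n)"
proof (cases "\<exists>y Q. eval B p [n] y Q")
  case True
  then show ?thesis using queries_eq eval_finite by metis
qed (simp add: queries_def)

text \<open>Since the use is the largest query plus one, the strict bound absorbs the separate case
  of no queries.\<close>

lemma use_fun_le_iff: "use_fun p B n \<le> m \<longleftrightarrow> (\<forall>k<n. queries p B k \<subseteq> {..<m})"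
proof -
  have "finite (\<Union>k<n. queries p B k)" by (simp add: finite_queries)
  then have "use_fun p B n \<le> m \<longleftrightarrow> (\<Union>k<n. queries p B k) \<subseteq> {..<m}"
    unfolding use_fun_def Let_def by (auto simp: Suc_le_eq subset_iff)
  then show ?thesis by blast
qed

section \<open>From reductions with bounded use to anti-complexity\<close>

lemma order_function_inverse:
  assumes "order_function f"
  shows "order_function (\<lambda>m. LEAST n. m \<le> f n)"
  unfolding order_function_def
proof (intro conjI allI)
  have f: "mono f" "\<And>b. \<exists>n. b \<le> f n" using assms by (auto simp: order_function_def)
  have "computable 1 (\<lambda>xs. LEAST n. (n # xs) ! 1 < Suc (f ((n # xs) ! 0)))"
    by (intro computable_Least_less computable_Suc computable_nth
        computable_recursive[OF recursive_order_function[OF assms]]) (use f(2) in \<open>auto simp: less_Suc_eq_le\<close>)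
  then show "recursive (\<lambda>m. LEAST n. m \<le> f n)"
    unfolding recursive_iff_computable by (simp add: less_Suc_eq_le)
  show "mono (\<lambda>m. LEAST n. m \<le> f n)"
  proof (rule monoI)
    fix a b :: nat
    assume "a \<le> b"
    moreover have "b \<le> f (LEAST n. b \<le> f n)" using f(2) by (rule LeastI_ex)
    ultimately show "(LEAST n. a \<le> f n) \<le> (LEAST n. b \<le> f n)" by (intro Least_le) simp
  qed
  fix b
  \<comment> \<open>Were the least index at most \<open>b\<close>, monotonicity would give
    \<open>Suc (f b) \<le> f b\<close>.\<close>
  have "Suc (f b) \<le> f (LEAST n. Suc (f b) \<le> f n)" using f(2) by (rule LeastI_ex)
  then have "\<not> (LEAST n. Suc (f b) \<le> f n) \<le> b"
    using monoD[OF f(1)] by (metis not_less_eq_eq)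
  then show "\<exists>m. b \<le> (LEAST n. m \<le> f n)" by (intro exI[of _ "Suc (f b)"]) simp
qed

lemma T_tu_reducible_imp_complexity:
  assumes "optimal U" "A \<le>\<^sub>T\<^sub>t\<^sub>u B" "order_function f"
  shows "\<exists>c. \<forall>n. complexity U (A \<restriction> f n) \<le> enat (n + c)"
proof -
  define h where "h m = (LEAST n. m \<le> f n)" for m
  have "order_function h"
    unfolding h_def using order_function_inverse[OF assms(3)] .
  then obtain p where p: "turing_reduction p A B" "\<And>n. use_fun p B n \<le> h n"
    using assms(2) unfolding T_tu_reducible_def by blast
  have h: "h (f n) \<le> n" for n unfolding h_def by (rule Least_le) simp
  \<comment> \<open>\<open>l\<close> answers a query from the code of a finite part of the oracle
    and will replace \<open>Query\<close>.\<close>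
  have "computable 2 (\<lambda>xs. code_nth (xs ! 1) (xs ! 0))"
    by (intro computable_code_nth computable_nth) auto
  then obtain l where l: "oracle_free l"
    "\<And>B xs. length xs = 2 \<Longrightarrow> eval B l xs (code_nth (xs ! 1) (xs ! 0)) {}"
    unfolding computable_def by blast
  have "computable 2 (\<lambda>xs. 2 * xs ! 0 + xs ! 1)"
    by (intro computable_arith) auto
  then obtain s where s: "oracle_free s"
    "\<And>B xs. length xs = 2 \<Longrightarrow> eval B s xs (2 * xs ! 0 + xs ! 1) {}"
    unfolding computable_def by blast
  obtain one where one: "oracle_free one" "\<And>B xs. length xs = 1 \<Longrightarrow> eval B one xs 1 {}"
    using computable_const[of 1 1] unfolding computable_def by blast
  have "computable 1 (\<lambda>xs. f (code_length (xs ! 0)))"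
    by (intro computable_recursive[OF recursive_order_function[OF assms(3)]]
        computable_code_length computable_nth) simp
  then obtain r where r: "oracle_free r"
    "\<And>B xs. length xs = 1 \<Longrightarrow> eval B r xs (f (code_length (xs ! 0))) {}"
    unfolding computable_def by blast
  let ?p = "subst_oracle l 1 p"
  \<comment> \<open>Starting from 1, the code of the empty string, the loop appends bit
    \<open>k\<close> of \<open>A\<close> in round \<open>k\<close>. Each round receives
    \<open>k\<close>, the code built so far and the oracle code.\<close>
  let ?loop = "PrimRec one (Comp s [Proj 1, Comp ?p [Proj 0, Proj 2]])"
  \<comment> \<open>This program maps \<open>B \<restriction> n\<close> to \<open>A \<restriction> f n\<close>.\<close>
  let ?q = "Comp ?loop [r, Proj 0]"
  have "oracle_free ?q"
    using l(1) s(1) one(1) r(1) oracle_free_subst_oracle by simp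
  then obtain c where c: "\<And>\<sigma> \<tau> Q. eval {} ?q [str_code \<sigma>] (str_code \<tau>) Q
      \<Longrightarrow> complexity U \<tau> \<le> enat (length \<sigma> + c)"
    using complexity_le_of_program[OF assms(1)] by blast
  have "complexity U (A \<restriction> f n) \<le> enat (n + c)" for n
  proof -
    let ?c = "str_code (B \<restriction> n)"
    have step: "eval {} ?p [k, ?c] (of_bool (k \<in> A)) {}" if "k < f n" for k
    proof -
      obtain Q where Q: "eval B p [k] (of_bool (k \<in> A)) Q"
        using p(1) unfolding turing_reduction_def by blast
      \<comment> \<open>All queries for arguments below \<open>f n\<close> lie below
        \<open>h (f n) \<le> n\<close>, so \<open>B \<restriction> n\<close> answers them.\<close>
      have "use_fun p B (f n) \<le> n" using p(2) h le_trans by blast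
      then have "Q \<subseteq> {..<n}"
        using that queries_eq[OF Q] unfolding use_fun_le_iff by blast
      then have "eval {} l [x, ?c] (of_bool (x \<in> B)) {}" if "x \<in> Q" for x
        using l(2)[of "[x, ?c]" "{}"] that by (auto simp: subset_iff)
      with Q have "eval {} (subst_oracle l (length [k]) p) ([k] @ [?c]) (of_bool (k \<in> A)) {}"
        by (rule eval_subst_oracle)
      then show ?thesis by simp
    qed
    have loop: "eval {} ?loop [k, ?c] (str_code (A \<restriction> k)) {}" if "k \<le> f n" for k
      using that
    proof (induction k)
      case 0
      have "eval {} one [?c] 1 {}" by (rule one(2)) simp
      then show ?case by (simp add: initial_segment_def eval.PrimRec_0)
    next
      case (Suc k)
      let ?xs = "[k, str_code (A \<restriction> k), ?c]"
      have "eval {} (Comp ?p [Proj 0, Proj 2]) ?xs (of_bool (k \<in> A)) ({} \<union> {} \<union> {})"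
        using Suc.prems by (intro eval_Comp2[OF _ _ step] eval_Proj) auto
      moreover have "eval {} (Proj 1) ?xs (str_code (A \<restriction> k)) {}"
        by (rule eval_Proj) auto
      moreover have "eval {} s [str_code (A \<restriction> k), of_bool (k \<in> A)] (str_code (A \<restriction> Suc k)) {}"
        using s(2)[of "[str_code (A \<restriction> k), of_bool (k \<in> A)]"] by (simp add: initial_segment_Suc)
      ultimately have "eval {} (Comp s [Proj 1, Comp ?p [Proj 0, Proj 2]]) ?xs
          (str_code (A \<restriction> Suc k)) {}"
        using eval_Comp2[of "{}" "Proj 1" ?xs _ "{}" "Comp ?p [Proj 0, Proj 2]" _ "{}"] by simp
      then show ?case
        using eval.PrimRec_Suc[OF Suc.IH] Suc.prems by simp
    qed
    have "eval {} r [?c] (f n) {}"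
      using r(2)[of "[?c]"] by simp
    moreover have "eval {} (Proj 0) [?c] ?c {}"
      by (rule eval_Proj) auto
    ultimately have "eval {} ?q [?c] (str_code (A \<restriction> f n)) ({} \<union> {} \<union> {})"
      using loop[OF order_refl] by (rule eval_Comp2)
    from c[OF this] show ?thesis by simp
  qed
  then show ?thesis by blast
qed

lemma T_tu_reducible_imp_anti_complex:
  assumes "optimal U" "A \<le>\<^sub>T\<^sub>t\<^sub>u B"
  shows "anti_complex U A"
proof (rule anti_complexI)
  fix f assume "order_function f"
  then obtain c where "\<forall>n. complexity U (A \<restriction> f n) \<le> enat (n + c)"
    using T_tu_reducible_imp_complexity[OF assms] by blast
  then show "\<exists>c. \<forall>\<^sub>\<infinity>n. complexity U (A \<restriction> f n) \<le> enat (n + c)"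
    by (intro exI[of _ c] ALL_MOST) simp
qed

text \<open>
  A primitive recursion on a truth value serves as a conditional that evaluates the second branch,
  and makes its queries, only if the condition holds.
\<close>

lemma uT_tu_reducible_imp_T_tu_reducible:
  assumes "A \<le>\<^sub>u\<^sub>T\<^sub>t\<^sub>u B"
  shows "A \<le>\<^sub>T\<^sub>t\<^sub>u B"
  unfolding T_tu_reducible_def
proof (intro allI impI)
  fix h assume "order_function h"
  with assms obtain p N where p: "turing_reduction p A B" "\<And>n. n \<ge> N \<Longrightarrow> use_fun p B n \<le> h n"
    unfolding uT_tu_reducible_def dominates_def MOST_nat_le by blast
  \<comment> \<open>The first \<open>N\<close> values of \<open>A\<close> form a constant lookup
    table \<open>t\<close>.\<close>
  have "computable 1 (\<lambda>xs. code_nth (str_code (A \<restriction> N)) (xs ! 0))"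
    by (intro computable_code_nth computable_arith) auto
  then obtain t where t:
    "\<And>B xs. length xs = 1 \<Longrightarrow> eval B t xs (code_nth (str_code (A \<restriction> N)) (xs ! 0)) {}"
    unfolding computable_def by blast
  have "computable 1 (\<lambda>xs. of_bool (N < Suc (xs ! 0)))"
    by (intro computable_arith) auto
  then obtain b where b: "\<And>B xs. length xs = 1 \<Longrightarrow> eval B b xs (of_bool (N < Suc (xs ! 0))) {}"
    unfolding computable_def by blast
  let ?cond = "PrimRec t (Comp p [Proj 2])"
  let ?p = "Comp ?cond [b, Proj 0]"
  have eval_p: "eval B ?p [n] y ({} \<union> {} \<union> Q)"
    if "eval B ?cond [of_bool (N \<le> n), n] y Q" for n y Q
    using b[of "[n]"] by (intro eval_Comp2[OF _ _ that] eval_Proj) (auto simp: less_Suc_eq_le)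
  have low: "eval B ?p [n] (of_bool (n \<in> A)) {}" if "n < N" for n
    using eval_p[of n _ "{}"] t[of "[n]" B] that by (simp add: eval.PrimRec_0)
  have high: "eval B ?p [n] (of_bool (n \<in> A)) (queries p B n)" if "N \<le> n" for n
  proof -
    obtain Q where Q: "eval B p [n] (of_bool (n \<in> A)) Q"
      using p(1) unfolding turing_reduction_def by blast
    let ?y = "code_nth (str_code (A \<restriction> N)) n"
    \<comment> \<open>The recursion performs the table lookup for large \<open>n\<close> as well;
      its result is discarded and it makes no queries.\<close>
    have "eval B ?cond [0, n] ?y {}"
      using t[of "[n]"] by (intro eval.PrimRec_0) simp
    moreover have "eval B (Comp p [Proj 2]) [0, ?y, n] (of_bool (n \<in> A)) ({} \<union> Q)"
      by (intro eval_Comp1[OF _ Q] eval_Proj) auto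
    ultimately have "eval B ?cond [Suc 0, n] (of_bool (n \<in> A)) ({} \<union> ({} \<union> Q))"
      by (rule eval.PrimRec_Suc)
    then show ?thesis
      using eval_p[of n _ Q] that queries_eq[OF Q] by simp
  qed
  have "turing_reduction ?p A B"
    unfolding turing_reduction_def using low high by (metis not_less)
  moreover have "use_fun ?p B n \<le> h n" for n
    unfolding use_fun_le_iff
  proof (intro allI impI)
    fix k assume "k < n"
    show "queries ?p B k \<subseteq> {..<h n}"
    proof (cases "k < N")
      case True
      then show ?thesis using queries_eq[OF low] by simp
    next
      case False
      then have "queries ?p B k = queries p B k" using queries_eq[OF high] by simp
      then show ?thesis
        using p(2)[of n] False \<open>k < n\<close> unfolding use_fun_le_iff by auto
    qed
  qed
  ultimately show "\<exists>p. turing_reduction p A B \<and> (\<forall>n. use_fun p B n \<le> h n)" by blast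
qed

section \<open>Computing a set from its shortest descriptions\<close>

text \<open>The search stops at the least suitable element, which is at most \<open>d k\<close> for
  every \<open>k\<close> with \<open>n < g_fun U A k\<close>. Hence the bound does not rely on
  \<open>d\<close> being monotone.\<close>

lemma star_set_reduction:
  fixes U A
  defines "d k \<equiv> str_code (shortest_description U (A \<restriction> g_fun U A k))"
  assumes "optimal U"
  shows "\<exists>p. turing_reduction p A (star_set U A)
    \<and> (\<forall>n k. n < g_fun U A k \<longrightarrow> queries p (star_set U A) n \<subseteq> {..d k})"
proof -
  let ?B = "star_set U A"
  have B: "?B = range d" by (simp add: star_set_def d_def)
  obtain u where u:
    "\<And>B \<sigma> \<tau>. U \<sigma> = Some \<tau> \<Longrightarrow> eval B u [str_code \<sigma>] (str_code \<tau>) {}"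
    using optimal_program[OF assms(2)] by blast
  have eval_u: "eval B u [d k] (str_code (A \<restriction> g_fun U A k)) {}" for B k
    unfolding d_def using u shortest_description(1)[OF assms(2)] .
  \<comment> \<open>A description determines its output, so whether an element of the set is long
    enough does not depend on the index \<open>k\<close> that represents it.\<close>
  have d_eqD: "g_fun U A k = g_fun U A j" if "d k = d j" for k j
  proof -
    have "eval {} u [d k] (str_code (A \<restriction> g_fun U A j)) {}"
      using eval_u[of "{}" j] that by simp
    then have "A \<restriction> g_fun U A j = A \<restriction> g_fun U A k"
      using eval_deterministic[OF eval_u] by (metis str_code_inject)
    then show ?thesis by (metis length_initial_segment)
  qed
  have "computable 2 (\<lambda>xs. 1 - of_bool (xs ! 1 < code_length (xs ! 0)))"
    by (intro computable_arith computable_code_length) auto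
  then obtain r where r: "\<And>B xs. length xs = 2
      \<Longrightarrow> eval B r xs (1 - of_bool (xs ! 1 < code_length (xs ! 0))) {}"
    unfolding computable_def by blast
  have "computable 2 (\<lambda>xs. code_nth (xs ! 0) (xs ! 1))"
    by (intro computable_code_nth computable_nth) auto
  then obtain s where s: "\<And>B xs. length xs = 2 \<Longrightarrow> eval B s xs (code_nth (xs ! 0) (xs ! 1)) {}"
    unfolding computable_def by blast
  obtain one where one: "\<And>B xs. length xs = 2 \<Longrightarrow> eval B one xs 1 {}"
    using computable_const[of 2 1] unfolding computable_def by blast
  \<comment> \<open>The query answer drives the recursion in \<open>?cond\<close>: \<open>u\<close>
    runs only on members of the set, since elsewhere \<open>U\<close> may be undefined. Success is
    reported as 0, as \<open>Mu\<close> requires.\<close>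
  let ?long = "Comp r [Comp u [Proj 2], Proj 3]"
  let ?cond = "PrimRec one ?long"
  let ?test = "Comp ?cond [Comp Query [Proj 0], Proj 0, Proj 1]"
  let ?p = "Comp s [Comp u [Mu ?test], Proj 0]"
  define good where "good n i \<longleftrightarrow> (\<exists>k. i = d k \<and> n < g_fun U A k)" for n i
  have cond: "eval ?B ?cond [of_bool (i \<in> ?B), i, n] (of_bool (\<not> good n i)) {}" for i n
  proof (cases "i \<in> ?B")
    case False
    then have "\<not> good n i" unfolding B good_def by blast
    with False one[of "[i, n]" ?B] show ?thesis by (simp add: eval.PrimRec_0)
  next
    case True
    then obtain k where k: "i = d k" unfolding B by blast
    then have good: "good n i \<longleftrightarrow> n < g_fun U A k"
      unfolding good_def by (metis d_eqD)
    let ?xs = "[0, 1, i, n]" and ?y = "str_code (A \<restriction> g_fun U A k)"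
    have "eval ?B (Comp u [Proj 2]) ?xs ?y ({} \<union> {})"
      using k by (intro eval_Comp1[OF _ eval_u] eval_Proj) auto
    moreover have "eval ?B (Proj 3) ?xs n {}"
      by (rule eval_Proj) auto
    moreover have "eval ?B r [?y, n] (of_bool (\<not> good n i)) {}"
    proof -
      have "of_bool (\<not> good n i) = (1 - of_bool (n < g_fun U A k) :: nat)"
        unfolding good by simp
      then show ?thesis using r[of "[?y, n]" ?B] by simp
    qed
    ultimately have "eval ?B ?long ?xs (of_bool (\<not> good n i)) ({} \<union> {} \<union> {} \<union> {})"
      by (rule eval_Comp2)
    moreover have "eval ?B ?cond [0, i, n] 1 {}"
      using one by (intro eval.PrimRec_0) simp
    ultimately show ?thesis
      using eval.PrimRec_Suc[of ?B one ?long 0 "[i, n]" 1 "{}"] True by simp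
  qed
  have test: "eval ?B ?test [i, n] (of_bool (\<not> good n i)) {i}" for i n
  proof -
    have "eval ?B (Comp Query [Proj 0]) [i, n] (of_bool (i \<in> ?B)) ({} \<union> {i})"
      by (intro eval_Comp1[OF _ eval.Query] eval_Proj) auto
    then have "eval ?B ?test [i, n] (of_bool (\<not> good n i))
        ((\<Union>j<length [Comp Query [Proj 0], Proj 0, Proj 1]. if j = 0 then {i} else {}) \<union> {})"
      by (intro eval.Comp[OF _ _ cond]) (auto simp: less_Suc_eq intro: eval_Proj)
    then show ?thesis by (simp add: lessThan_Suc)
  qed
  have run: "\<exists>i. good n i \<and> (\<forall>k. n < g_fun U A k \<longrightarrow> i \<le> d k)
      \<and> eval ?B ?p [n] (of_bool (n \<in> A)) {..i}" for n
  proof -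
    define i where "i = (LEAST i. good n i)"
    \<comment> \<open>The search terminates because \<open>A \<restriction> n\<close> has finite
      complexity, which places \<open>n\<close> below some value of \<open>g_fun\<close>.\<close>
    obtain k where "complexity U (A \<restriction> n) \<le> enat k"
      using complexity_finite[OF assms(2)] by blast
    then have "n < g_fun U A k" by (rule less_g_fun)
    then have "good n (d k)" unfolding good_def by blast
    then have i: "good n i" unfolding i_def by (rule LeastI)
    have least: "i \<le> d k" if "n < g_fun U A k" for k
      unfolding i_def by (rule Least_le) (use that good_def in blast)
    obtain j where j: "i = d j" "n < g_fun U A j" using i unfolding good_def by blast
    have "eval ?B ?test [m, n] (Suc 0) {m}" if "m < i" for m
      using test[of m n] not_less_Least[OF that[unfolded i_def]] by simp
    moreover have "eval ?B ?test [i, n] 0 {i}" using test[of i n] i by simp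
    ultimately have "eval ?B (Mu ?test) [n] i (\<Union>m\<le>i. {m})"
      by (intro eval.Mu[where Qs = "\<lambda>m. {m}" and ys = "\<lambda>_. 0"]) auto
    then have "eval ?B (Mu ?test) [n] (d j) {..i}" using j(1) by simp
    then have "eval ?B (Comp u [Mu ?test]) [n] (str_code (A \<restriction> g_fun U A j)) ({..i} \<union> {})"
      using eval_u by (rule eval_Comp1)
    moreover have "eval ?B (Proj 0) [n] n {}"
      by (rule eval_Proj) auto
    moreover have "eval ?B s [str_code (A \<restriction> g_fun U A j), n] (of_bool (n \<in> A)) {}"
      using s[of "[str_code (A \<restriction> g_fun U A j), n]"] j(2) by simp
    ultimately have "eval ?B ?p [n] (of_bool (n \<in> A)) ({..i} \<union> {} \<union> {} \<union> {})"
      by (rule eval_Comp2)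
    then have "eval ?B ?p [n] (of_bool (n \<in> A)) {..i}" by simp
    with i least show ?thesis by (intro exI[of _ i] conjI allI impI)
  qed
  have "turing_reduction ?p A ?B"
    unfolding turing_reduction_def
  proof
    fix n
    from run[of n] obtain i where "eval ?B ?p [n] (of_bool (n \<in> A)) {..i}" by (elim exE conjE)
    then show "\<exists>Q. eval ?B ?p [n] (of_bool (n \<in> A)) Q" ..
  qed
  moreover have "queries ?p ?B n \<subseteq> {..d k}" if "n < g_fun U A k" for n k
  proof -
    obtain i where i: "\<forall>k. n < g_fun U A k \<longrightarrow> i \<le> d k"
      "eval ?B ?p [n] (of_bool (n \<in> A)) {..i}"
      using run[of n] by (elim exE conjE)
    then have "i \<le> d k" using that by simp
    then show ?thesis using queries_eq[OF i(2)] by simp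
  qed
  ultimately show ?thesis by (intro exI[of _ ?p] conjI allI impI)
qed

section \<open>Dominance makes the use of this reduction grow slowly\<close>

lemma dominant_imp_uT_tu_reducible:
  assumes "optimal U" "dominant (g_fun U A)"
  shows "A \<le>\<^sub>u\<^sub>T\<^sub>t\<^sub>u star_set U A"
proof -
  let ?g = "g_fun U A"
  let ?d = "\<lambda>k. str_code (shortest_description U (A \<restriction> ?g k))"
  obtain p where p: "turing_reduction p A (star_set U A)"
    "\<And>n k. n < ?g k \<Longrightarrow> queries p (star_set U A) n \<subseteq> {..?d k}"
    using star_set_reduction[OF assms(1), of A] by blast
  obtain c where c: "\<And>k. complexity U (A \<restriction> ?g k) \<le> enat (k + c)"
    using complexity_g_fun[OF assms(1)] by blast
  have d: "?d k < 2 ^ Suc (k + c)" for k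
  proof -
    have "length (shortest_description U (A \<restriction> ?g k)) \<le> k + c"
      using shortest_description(2)[OF assms(1) c] .
    then have "(2::nat) ^ Suc (length (shortest_description U (A \<restriction> ?g k))) \<le> 2 ^ Suc (k + c)"
      by (intro power_increasing) auto
    then show ?thesis using str_code_bounds(2) less_le_trans by blast
  qed
  have "dominates h (use_fun p (star_set U A))" if h: "order_function h" for h
  proof -
    \<comment> \<open>At \<open>R k\<close> the function \<open>h\<close> has reached the bound on
      \<open>?d (Suc k)\<close>. The index is shifted because the argument below bounds
      \<open>R\<close> at the predecessor of the relevant \<open>k\<close>.\<close>
    define R where "R k = (LEAST m. 2 ^ Suc (Suc k + c) \<le> h m)" for k
    have inv: "recursive (\<lambda>k. LEAST m. k \<le> h m)"
      using recursive_order_function[OF order_function_inverse[OF h]] .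
    have "computable 1 (\<lambda>xs. 2 ^ Suc (Suc (xs ! 0) + c))"
      by (intro computable_arith) simp
    then have "computable 1 (\<lambda>xs. R (xs ! 0))"
      unfolding R_def by (rule computable_recursive[OF inv])
    then have "recursive R" by (simp add: recursive_iff_computable)
    then obtain N where N: "\<And>k. k \<ge> N \<Longrightarrow> R k \<le> ?g k"
      using assms(2) unfolding dominant_def dominates_def MOST_nat_le by blast
    have R: "2 ^ Suc (Suc k + c) \<le> h (R k)" for k
    proof -
      have "\<exists>m. 2 ^ Suc (Suc k + c) \<le> h m" using h unfolding order_function_def by blast
      then show ?thesis unfolding R_def by (rule LeastI_ex)
    qed
    \<comment> \<open>Beyond the first values of \<open>?g\<close>, the least \<open>k\<close> with
      \<open>n \<le> ?g k\<close> exceeds \<open>N\<close>, so domination applies to its predecessor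
      \<open>i\<close>, giving \<open>R i \<le> ?g i < n\<close>.\<close>
    have "use_fun p (star_set U A) n \<le> h n" if n: "n > Max (?g ` {..N})" for n
    proof -
      \<comment> \<open>The weak inequality suffices, since the use at \<open>n\<close> concerns
        only arguments below \<open>n\<close>.\<close>
      define k where "k = (LEAST k. n \<le> ?g k)"
      obtain j where "complexity U (A \<restriction> n) \<le> enat j"
        using complexity_finite[OF assms(1)] by blast
      then have "n \<le> ?g j" using less_g_fun less_imp_le by blast
      then have k: "n \<le> ?g k" unfolding k_def by (rule LeastI)
      have "?g i < n" if "i \<le> N" for i
      proof -
        have "?g i \<le> Max (?g ` {..N})" using that by (intro Max_ge) auto
        from this n show ?thesis by (rule le_less_trans)
      qed
      with k have "\<not> k \<le> N" by (meson not_le)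
      then obtain i where i: "k = Suc i" "i \<ge> N" by (cases k) auto
      have "\<not> n \<le> ?g i" using not_less_Least[of i "\<lambda>k. n \<le> ?g k"] i(1) k_def by simp
      then have "R i \<le> n" using N[OF i(2)] by simp
      then have "h (R i) \<le> h n" using h by (auto simp: order_function_def dest: monoD)
      with R[of i] have "2 ^ Suc (k + c) \<le> h n" using i(1) by simp
      with d[of k] have "?d k < h n" by (rule less_le_trans)
      show ?thesis
        unfolding use_fun_le_iff
      proof (intro allI impI)
        fix m assume "m < n"
        with k have "queries p (star_set U A) m \<subseteq> {..?d k}" by (intro p(2)) simp
        also have "\<dots> \<subseteq> {..<h n}" using \<open>?d k < h n\<close> by auto
        finally show "queries p (star_set U A) m \<subseteq> {..<h n}" .
      qed
    qed
    then show ?thesis unfolding dominates_def MOST_nat by blast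
  qed
  with p(1) show ?thesis unfolding uT_tu_reducible_def by blast
qed

theorem theorem3p8:
  fixes U :: machine and A :: "nat set"
  assumes "optimal U"
  shows "((\<exists>B. A \<le>\<^sub>T\<^sub>t\<^sub>u B) \<longleftrightarrow> anti_complex U A)
    \<and> (anti_complex U A \<longleftrightarrow> dominant (g_fun U A))
    \<and> (dominant (g_fun U A) \<longleftrightarrow> A \<le>\<^sub>u\<^sub>T\<^sub>t\<^sub>u star_set U A)"
  using T_tu_reducible_imp_anti_complex[OF assms] anti_complex_imp_dominant
    dominant_imp_anti_complex[OF assms] dominant_imp_uT_tu_reducible[OF assms]
    uT_tu_reducible_imp_T_tu_reducible
  by blast

end
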